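(* (Atomic Reversibility) Let $G\in\mathbb{GS}$ and suppose $A\in G^{\mathcal L}$ is reversible through $B=\langle\emptyset^\ell\mid B^{\mathcal R}\rangle$, i.e. $B$ is a left-atomic Right option of $A$ with $B\preccurlyeq G$. (1) If $\underline{Ls}(G)=\underline{Rs}(G^L)$ for some $G^L\in G^{\mathcal L}\setminus\{A\}$, then $G\sim\langle G^{\mathcal L}\setminus\{A\}\mid G^{\mathcal R}\rangle$. (2) If $\underline{Ls}(G)=\underline{Rs}(A)>\underline{Rs}(G^L)$ for all $G^L\in G^{\mathcal L}\setminus\{A\}$, then $G\sim\langle\langle\emptyset^\ell\mid B\rangle,\,G^{\mathcal L}\setminus\{A\}\mid G^{\mathcal R}\rangle$.
   Context: A scoring game is written $G=\langle G^{\mathcal L}\mid G^{\mathcal R}\rangle$, where each of $G^{\mathcal L}$ (Left options) and $G^{\mathcal R}$ (Right options) is either a finite nonempty set of scoring games or an atom $\emptyset^{s}$, $s\in\mathbb R$ (the player to move on that side cannot move and the game ends with score $s$); game trees are finite. An atom occurring in $G$ is an atom of $G$ or of any follower of $G$. $G$ is guaranteed if for every follower $K$ of $G$: if $K^{\mathcal L}=\emptyset^\ell$ then $\ell\le s$ for every atom $\emptyset^s$ occurring in $K$, and if $K^{\mathcal R}=\emptyset^r$ then $s\le r$ for every atom $\emptyset^s$ occurring in $K$; $\mathbb{GS}$ is the class of guaranteed games. Disjunctive sum $G+H$: Left options are $G^L+H$ and $G+H^L$, except if both are left-atomic with atoms $\emptyset^{\ell_1},\emptyset^{\ell_2}$,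 then $(G+H)^{\mathcal L}=\emptyset^{\ell_1+\ell_2}$; Right symmetric. Stops: $Ls(G)=\ell$ if $G^{\mathcal L}=\emptyset^\ell$, otherwise $\max_{G^L}Rs(G^L)$; $Rs(G)=r$ if $G^{\mathcal R}=\emptyset^r$, otherwise $\min_{G^R}Ls(G^R)$. $G\succcurlyeq H$ iff $Ls(G+X)\ge Ls(H+X)$ and $Rs(G+X)\ge Rs(H+X)$ for all $X\in\mathbb{GS}$; $B\preccurlyeq G$ means $G\succcurlyeq B$; $G\sim H$ iff both $G\succcurlyeq H$ and $H\succcurlyeq G$. Conjugate: $\overleftrightarrow{G}=\langle\overleftrightarrow{G^{\mathcal R}}\mid\overleftrightarrow{G^{\mathcal L}}\rangle$ (atom $\emptyset^s$ becomes $\emptyset^{-s}$). Waiting moves: $\widehat 0=\langle\emptyset^0\mid\emptyset^0\rangle$, $\widehat{k+1}=\langle\widehat k\mid\emptyset^0\rangle$, $-\widehat k=\overleftrightarrow{\widehat k}$. Right-pass-allowed stops: $\underline{Ls}(G)=\min_{k\ge0}Ls(G-\widehat k)$, $\underline{Rs}(G)=\min_{k\ge0}Rs(G-\widehat k)$. *)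

theory Defs
  imports Complex_Main "HOL-Library.FSet"
begin

text \<open>
  The datatype also contains trees with an empty set of options on some side;
  \<open>scoring_game\<close> below excludes them.
\<close>

datatype 'a side = Atom real | Opts "'a fset"

datatype game = Game (left: "game side") (right: "game side")

fun side_opts :: "'a side \<Rightarrow> 'a fset" where
  "side_opts (Atom s) = {||}"
| "side_opts (Opts S) = S"

definition left_opts :: "game \<Rightarrow> game fset" where
  "left_opts G = side_opts (left G)"

definition right_opts :: "game \<Rightarrow> game fset" where
  "right_opts G = side_opts (right G)"

lemma size_side_opts [termination_simp]:
  assumes "x |\<in>| side_opts S"
  shows "size x < size_side size S"
proof (cases S)
  case (Opts T)
  have "Suc (size x) \<le> (\<Sum>x\<in>fset T. Suc (size x))"
    using assms Opts by (intro member_le_sum) auto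
  then show ?thesis using Opts by simp
qed (use assms in simp)

lemma size_Opts_mem [termination_simp]:
  "x |\<in>| S \<Longrightarrow> size x < (\<Sum>x\<in>fset S. Suc (size x))"
  using size_side_opts[of x "Opts S"] member_le_sum[of x "fset S" "\<lambda>x. Suc (size x)"] by simp

text \<open>The followers of a game include the game itself.\<close>

inductive follower :: "game \<Rightarrow> game \<Rightarrow> bool" where
  follower_refl: "follower G G"
| follower_left: "H |\<in>| left_opts G \<Longrightarrow> follower K H \<Longrightarrow> follower K G"
| follower_right: "H |\<in>| right_opts G \<Longrightarrow> follower K H \<Longrightarrow> follower K G"

definition scoring_game :: "game \<Rightarrow> bool" where
  "scoring_game G \<longleftrightarrow> (\<forall>K. follower K G \<longrightarrow> left K \<noteq> Opts {||} \<and> right K \<noteq> Opts {||})"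

definition atoms :: "game \<Rightarrow> real set" where
  "atoms G = {s. \<exists>K. follower K G \<and> (left K = Atom s \<or> right K = Atom s)}"

definition guaranteed :: "game \<Rightarrow> bool" where
  "guaranteed G \<longleftrightarrow> (\<forall>K. follower K G \<longrightarrow>
     (\<forall>l. left K = Atom l \<longrightarrow> (\<forall>s\<in>atoms K. l \<le> s)) \<and>
     (\<forall>r. right K = Atom r \<longrightarrow> (\<forall>s\<in>atoms K. s \<le> r)))"

definition GS :: "game set" where
  "GS = {G. scoring_game G \<and> guaranteed G}"

function gplus :: "game \<Rightarrow> game \<Rightarrow> game" (infixl "\<oplus>" 65) where
  "Game GL GR \<oplus> Game HL HR = Game
     (case (GL, HL) of
        (Atom s, Atom t) \<Rightarrow> Atom (s + t)
      | _ \<Rightarrow> Opts (((\<lambda>G'. G' \<oplus> Game HL HR) |`| side_opts GL) |\<union>|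
                  ((\<lambda>H'. Game GL GR \<oplus> H') |`| side_opts HL)))
     (case (GR, HR) of
        (Atom s, Atom t) \<Rightarrow> Atom (s + t)
      | _ \<Rightarrow> Opts (((\<lambda>G'. G' \<oplus> Game HL HR) |`| side_opts GR) |\<union>|
                  ((\<lambda>H'. Game GL GR \<oplus> H') |`| side_opts HR)))"
  by pat_completeness auto
termination
  by (relation "measure (\<lambda>(G, H). size G + size H)")
     (auto dest: size_side_opts size_Opts_mem)

fun Ls :: "game \<Rightarrow> real" and Rs :: "game \<Rightarrow> real" where
  "Ls (Game (Atom l) R) = l"
| "Ls (Game (Opts S) R) = Max (Rs ` fset S)"
| "Rs (Game L (Atom r)) = r"
| "Rs (Game L (Opts S)) = Min (Ls ` fset S)"

definition game_ge :: "game \<Rightarrow> game \<Rightarrow> bool" (infix "\<succeq>" 50) where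
  "G \<succeq> H \<longleftrightarrow> (\<forall>X\<in>GS. Ls (G \<oplus> X) \<ge> Ls (H \<oplus> X) \<and> Rs (G \<oplus> X) \<ge> Rs (H \<oplus> X))"

abbreviation game_le :: "game \<Rightarrow> game \<Rightarrow> bool" (infix "\<preceq>" 50) where
  "H \<preceq> G \<equiv> G \<succeq> H"

definition game_equiv :: "game \<Rightarrow> game \<Rightarrow> bool" (infix "\<sim>" 50) where
  "G \<sim> H \<longleftrightarrow> G \<succeq> H \<and> H \<succeq> G"

fun conjugate :: "game \<Rightarrow> game" where
  "conjugate (Game L R) = Game
     (case R of Atom s \<Rightarrow> Atom (- s) | Opts S \<Rightarrow> Opts (conjugate |`| S))
     (case L of Atom s \<Rightarrow> Atom (- s) | Opts S \<Rightarrow> Opts (conjugate |`| S))"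

fun waiting :: "nat \<Rightarrow> game" where
  "waiting 0 = Game (Atom 0) (Atom 0)"
| "waiting (Suc k) = Game (Opts {|waiting k|}) (Atom 0)"

definition Ls_right_pass :: "game \<Rightarrow> real" where
  "Ls_right_pass G = Min (range (\<lambda>k. Ls (G \<oplus> conjugate (waiting k))))"

definition Rs_right_pass :: "game \<Rightarrow> real" where
  "Rs_right_pass G = Min (range (\<lambda>k. Rs (G \<oplus> conjugate (waiting k))))"


text \<open>
  On scoring games the minima defining the right-pass-allowed stops range over finite sets,
  hence exist.
\<close>

lemma scoring_game_Game:
  "scoring_game (Game L R) \<longleftrightarrow> L \<noteq> Opts {||} \<and> R \<noteq> Opts {||} \<and>
     (\<forall>H. H |\<in>| side_opts L \<longrightarrow> scoring_game H) \<and> (\<forall>H. H |\<in>| side_opts R \<longrightarrow> scoring_game H)"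
  unfolding scoring_game_def
  by (subst follower.simps)
     (auto simp: left_opts_def right_opts_def intro: follower.intros)

lemma atoms_Game:
  "atoms (Game L R) = {s. L = Atom s \<or> R = Atom s} \<union>
     (\<Union>H\<in>fset (side_opts L). atoms H) \<union> (\<Union>H\<in>fset (side_opts R). atoms H)"
  unfolding atoms_def
  by (subst follower.simps) (auto simp: left_opts_def right_opts_def)

lemma finite_atoms: "finite (atoms G)"
proof (induction "size G" arbitrary: G rule: less_induct)
  case less
  obtain L R where G: "G = Game L R" by (cases G)
  have "finite (atoms H)" if "H |\<in>| side_opts L \<or> H |\<in>| side_opts R" for H
    using that G by (intro less) (auto dest!: size_side_opts)
  moreover have "finite {s. L = Atom s \<or> R = Atom s}"
    by (rule finite_subset[of _ "{THE s. L = Atom s, THE s. R = Atom s}"]) auto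
  ultimately show ?case unfolding G atoms_Game by auto
qed

lemma stops_in_atoms: "scoring_game G \<Longrightarrow> Ls G \<in> atoms G \<and> Rs G \<in> atoms G"
proof (induction "size G" arbitrary: G rule: less_induct)
  case less
  obtain L R where G: "G = Game L R" by (cases G)
  have IH: "Ls H \<in> atoms H \<and> Rs H \<in> atoms H"
    if "H |\<in>| side_opts L \<or> H |\<in>| side_opts R" for H
    using that less(2) unfolding G scoring_game_Game
    by (intro less(1)) (auto simp: G dest: size_side_opts)
  have "Ls G \<in> atoms G"
  proof (cases L)
    case (Opts S)
    then have "fset S \<noteq> {}" using less(2) by (auto simp: G scoring_game_Game)
    then have "Ls G \<in> Rs ` fset S" unfolding G Opts Ls.simps by (intro Max_in) auto
    then obtain H where "H |\<in>| S" "Ls G = Rs H" by auto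
    moreover from this have "Rs H \<in> atoms H" using IH Opts by simp
    ultimately show ?thesis using Opts by (auto simp: G atoms_Game)
  qed (simp add: G atoms_Game)
  moreover have "Rs G \<in> atoms G"
  proof (cases R)
    case (Opts S)
    then have "fset S \<noteq> {}" using less(2) by (auto simp: G scoring_game_Game)
    then have "Rs G \<in> Ls ` fset S" unfolding G Opts Rs.simps by (intro Min_in) auto
    then obtain H where "H |\<in>| S" "Rs G = Ls H" by auto
    moreover from this have "Ls H \<in> atoms H" using IH Opts by simp
    ultimately show ?thesis using Opts by (auto simp: G atoms_Game)
  qed (simp add: G atoms_Game)
  ultimately show ?case by simp
qed

lemma scoring_game_gplus:
  "scoring_game G \<Longrightarrow> scoring_game H \<Longrightarrow> scoring_game (G \<oplus> H)"
proof (induction G H rule: gplus.induct)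
  case (1 GL GR HL HR)
  then show ?case
    by (cases GL; cases GR; cases HL; cases HR) (auto simp: scoring_game_Game)
qed

lemma atoms_gplus: "x \<in> atoms (G \<oplus> H) \<Longrightarrow> \<exists>s\<in>atoms G. \<exists>t\<in>atoms H. x = s + t"
proof (induction "size G + size H" arbitrary: G H rule: less_induct)
  case less
  obtain GL GR where G: "G = Game GL GR" by (cases G)
  obtain HL HR where H: "H = Game HL HR" by (cases H)
  have "(\<exists>s t. x = s + t \<and> (GL = Atom s \<and> HL = Atom t \<or> GR = Atom s \<and> HR = Atom t)) \<or>
    (\<exists>G'. (G' |\<in>| side_opts GL \<or> G' |\<in>| side_opts GR) \<and> x \<in> atoms (G' \<oplus> H)) \<or>
    (\<exists>H'. (H' |\<in>| side_opts HL \<or> H' |\<in>| side_opts HR) \<and> x \<in> atoms (G \<oplus> H'))"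
    using less(2) unfolding G H
    by (cases GL; cases HL; cases GR; cases HR) (auto simp: atoms_Game)
  then consider s t where "x = s + t" "GL = Atom s \<and> HL = Atom t \<or> GR = Atom s \<and> HR = Atom t"
    | G' where "G' |\<in>| side_opts GL \<or> G' |\<in>| side_opts GR" "x \<in> atoms (G' \<oplus> H)"
    | H' where "H' |\<in>| side_opts HL \<or> H' |\<in>| side_opts HR" "x \<in> atoms (G \<oplus> H')"
    by blast
  then show ?case
  proof cases
    case 1
    then show ?thesis unfolding G H atoms_Game by blast
  next
    case (2 G')
    then have "\<exists>s\<in>atoms G'. \<exists>t\<in>atoms H. x = s + t"
      by (intro less(1)) (auto simp: G dest: size_side_opts)
    then show ?thesis using 2(1) unfolding G atoms_Game by blast
  next
    case (3 H')
    then have "\<exists>s\<in>atoms G. \<exists>t\<in>atoms H'. x = s + t"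
      by (intro less(1)) (auto simp: H dest: size_side_opts)
    then show ?thesis using 3(1) unfolding H atoms_Game by blast
  qed
qed

lemma conjugate_waiting:
  "scoring_game (conjugate (waiting k)) \<and> atoms (conjugate (waiting k)) = {0}"
  by (induction k) (auto simp: scoring_game_Game atoms_Game)

lemma
  assumes "scoring_game G"
  shows finite_Ls_right_pass: "finite (range (\<lambda>k. Ls (G \<oplus> conjugate (waiting k))))"
    and finite_Rs_right_pass: "finite (range (\<lambda>k. Rs (G \<oplus> conjugate (waiting k))))"
proof -
  have "Ls (G \<oplus> conjugate (waiting k)) \<in> atoms G \<and> Rs (G \<oplus> conjugate (waiting k)) \<in> atoms G" for k
    using stops_in_atoms[OF scoring_game_gplus[OF assms conjunct1[OF conjugate_waiting[of k]]]]
    by (auto dest!: atoms_gplus simp: conjugate_waiting)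
  then show "finite (range (\<lambda>k. Ls (G \<oplus> conjugate (waiting k))))"
    and "finite (range (\<lambda>k. Rs (G \<oplus> conjugate (waiting k))))"
    by (auto intro: finite_subset[OF _ finite_atoms[of G]])
qed

end

theory Submission
  imports Defs
begin

text \<open>
  Write \<open>H\<close> for the game obtained from \<open>G\<close> by deleting or replacing \<open>A\<close>. Comparing \<open>G \<oplus> X\<close> with
  \<open>H \<oplus> X\<close> by induction on \<open>X\<close>, the only critical moves are those to \<open>A \<oplus> X\<close>, which Right may answer
  with \<open>B \<oplus> X\<close>. If Left then has a move, it is to some \<open>B \<oplus> X'\<close>, and \<open>B \<preceq> G\<close> lets \<open>X'\<close> be played in
  \<open>G \<oplus> X\<close> directly. Otherwise \<open>X\<close> has a left atom \<open>x\<close> and Left got at most \<open>l + x\<close>. In \<open>H \<oplus> X\<close> she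
  gets as much from any option \<open>C\<close> whose right-pass-allowed Right stop is at least \<open>l\<close>: as \<open>X\<close> is
  guaranteed, all its atoms are at least \<open>x\<close>, so \<open>X\<close> is no better for Right than the score \<open>x\<close>
  together with sufficiently many waiting moves. In the first part \<open>C\<close> is the given \<open>G\<^sup>L\<close>, in the
  second it is \<open>\<langle>\<emptyset>\<^sup>l | B\<rangle>\<close>.
\<close>

subsection \<open>Options and stops of disjunctive sums\<close>

lemma left_gplus:
  "left (G \<oplus> H) = (case (left G, left H) of
      (Atom s, Atom t) \<Rightarrow> Atom (s + t)
    | _ \<Rightarrow> Opts ((\<lambda>G'. G' \<oplus> H) |`| left_opts G |\<union>| (\<lambda>H'. G \<oplus> H') |`| left_opts H))"
  by (cases G; cases H) (simp add: left_opts_def split: side.splits)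

lemma right_gplus:
  "right (G \<oplus> H) = (case (right G, right H) of
      (Atom s, Atom t) \<Rightarrow> Atom (s + t)
    | _ \<Rightarrow> Opts ((\<lambda>G'. G' \<oplus> H) |`| right_opts G |\<union>| (\<lambda>H'. G \<oplus> H') |`| right_opts H))"
  by (cases G; cases H) (simp add: right_opts_def split: side.splits)

lemma left_opts_gplus:
  "left_opts (G \<oplus> H) = (\<lambda>G'. G' \<oplus> H) |`| left_opts G |\<union>| (\<lambda>H'. G \<oplus> H') |`| left_opts H"
  by (subst left_opts_def, subst left_gplus) (auto simp: left_opts_def split: side.splits)

lemma right_opts_gplus:
  "right_opts (G \<oplus> H) = (\<lambda>G'. G' \<oplus> H) |`| right_opts G |\<union>| (\<lambda>H'. G \<oplus> H') |`| right_opts H"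
  by (subst right_opts_def, subst right_gplus) (auto simp: right_opts_def split: side.splits)

lemma size_left_opt: "G' |\<in>| left_opts G \<Longrightarrow> size G' < size G"
  by (cases G) (auto simp: left_opts_def dest: size_side_opts)

lemma size_right_opt: "G' |\<in>| right_opts G \<Longrightarrow> size G' < size G"
  by (cases G) (auto simp: right_opts_def dest: size_side_opts)

lemma Rs_left_opt_le_Ls: "G' |\<in>| left_opts G \<Longrightarrow> Rs G' \<le> Ls G"
  by (cases G rule: Ls.cases) (auto simp: left_opts_def)

lemma Rs_le_Ls_right_opt: "G' |\<in>| right_opts G \<Longrightarrow> Rs G \<le> Ls G'"
  by (cases G rule: Rs.cases) (auto simp: right_opts_def)

lemma Rs_left_opt_gplus_le_Ls: "G' |\<in>| left_opts G \<Longrightarrow> Rs (G' \<oplus> H) \<le> Ls (G \<oplus> H)"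
  by (rule Rs_left_opt_le_Ls) (auto simp: left_opts_gplus)

lemma Rs_gplus_left_opt_le_Ls: "H' |\<in>| left_opts H \<Longrightarrow> Rs (G \<oplus> H') \<le> Ls (G \<oplus> H)"
  by (rule Rs_left_opt_le_Ls) (auto simp: left_opts_gplus)

lemma Rs_le_Ls_right_opt_gplus: "G' |\<in>| right_opts G \<Longrightarrow> Rs (G \<oplus> H) \<le> Ls (G' \<oplus> H)"
  by (rule Rs_le_Ls_right_opt) (auto simp: right_opts_gplus)

lemma Rs_le_Ls_gplus_right_opt: "H' |\<in>| right_opts H \<Longrightarrow> Rs (G \<oplus> H) \<le> Ls (G \<oplus> H')"
  by (rule Rs_le_Ls_right_opt) (auto simp: right_opts_gplus)

lemma Ls_left_atom: "left G = Atom s \<Longrightarrow> Ls G = s"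
  by (cases G) simp

lemma Rs_right_atom: "right G = Atom s \<Longrightarrow> Rs G = s"
  by (cases G) simp

lemma Ls_attained:
  assumes "left_opts G \<noteq> {||}"
  obtains G' where "G' |\<in>| left_opts G" "Ls G = Rs G'"
proof -
  obtain S R where G: "G = Game (Opts S) R" "S \<noteq> {||}"
    using assms by (cases G rule: Ls.cases) (auto simp: left_opts_def)
  then have "Ls G \<in> Rs ` fset S"
    unfolding G Ls.simps by (intro Max_in) auto
  then show ?thesis using that by (auto simp: G left_opts_def)
qed

lemma Rs_attained:
  assumes "right_opts G \<noteq> {||}"
  obtains G' where "G' |\<in>| right_opts G" "Rs G = Ls G'"
proof -
  obtain S L where G: "G = Game L (Opts S)" "S \<noteq> {||}"
    using assms by (cases G rule: Rs.cases) (auto simp: right_opts_def)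
  then have "Rs G \<in> Ls ` fset S"
    unfolding G Rs.simps by (intro Min_in) auto
  then show ?thesis using that by (auto simp: G right_opts_def)
qed

lemma Ls_gplus_cases:
  assumes "left G \<noteq> Opts {||}" "left H \<noteq> Opts {||}"
  obtains (atoms) s t where "left G = Atom s" "left H = Atom t" "Ls (G \<oplus> H) = s + t"
    | (fst) G' where "G' |\<in>| left_opts G" "Ls (G \<oplus> H) = Rs (G' \<oplus> H)"
    | (snd) H' where "H' |\<in>| left_opts H" "Ls (G \<oplus> H) = Rs (G \<oplus> H')"
proof (cases "left_opts (G \<oplus> H) = {||}")
  case True
  then obtain s t where "left G = Atom s" "left H = Atom t"
    using assms unfolding left_opts_gplus
    by (cases "left G"; cases "left H") (auto simp: left_opts_def)
  then show ?thesis by (simp add: atoms Ls_left_atom left_gplus)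
next
  case False
  then show ?thesis
    by (rule Ls_attained) (use fst snd in \<open>auto simp: left_opts_gplus\<close>)
qed

lemma Rs_gplus_cases:
  assumes "right G \<noteq> Opts {||}" "right H \<noteq> Opts {||}"
  obtains (atoms) s t where "right G = Atom s" "right H = Atom t" "Rs (G \<oplus> H) = s + t"
    | (fst) G' where "G' |\<in>| right_opts G" "Rs (G \<oplus> H) = Ls (G' \<oplus> H)"
    | (snd) H' where "H' |\<in>| right_opts H" "Rs (G \<oplus> H) = Ls (G \<oplus> H')"
proof (cases "right_opts (G \<oplus> H) = {||}")
  case True
  then obtain s t where "right G = Atom s" "right H = Atom t"
    using assms unfolding right_opts_gplus
    by (cases "right G"; cases "right H") (auto simp: right_opts_def)
  then show ?thesis by (simp add: atoms Rs_right_atom right_gplus)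
next
  case False
  then show ?thesis
    by (rule Rs_attained) (use fst snd in \<open>auto simp: right_opts_gplus\<close>)
qed

subsection \<open>Guaranteed games and bounds on atoms\<close>

lemma scoring_game_sides:
  "scoring_game G \<Longrightarrow> left G \<noteq> Opts {||} \<and> right G \<noteq> Opts {||}"
  by (cases G) (simp add: scoring_game_Game)

lemma scoring_game_right_opt: "scoring_game G \<Longrightarrow> G' |\<in>| right_opts G \<Longrightarrow> scoring_game G'"
  by (cases G) (simp add: scoring_game_Game right_opts_def)

lemma atoms_right_opt: "G' |\<in>| right_opts G \<Longrightarrow> atoms G' \<subseteq> atoms G"
  by (cases G) (auto simp: atoms_Game right_opts_def)

lemma right_atom_in_atoms: "right G = Atom r \<Longrightarrow> r \<in> atoms G"
  by (cases G) (simp add: atoms_Game)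

lemma atoms_gplus_ge:
  assumes "\<forall>s\<in>atoms G. a \<le> s" "\<forall>t\<in>atoms H. b \<le> t"
  shows "\<forall>s\<in>atoms (G \<oplus> H). a + b \<le> s"
  using assms by (fastforce dest!: atoms_gplus intro: add_mono)

lemma GS_Game:
  "Game L R \<in> GS \<longleftrightarrow> L \<noteq> Opts {||} \<and> R \<noteq> Opts {||} \<and>
     (\<forall>H. H |\<in>| side_opts L \<longrightarrow> H \<in> GS) \<and> (\<forall>H. H |\<in>| side_opts R \<longrightarrow> H \<in> GS) \<and>
     (\<forall>l. L = Atom l \<longrightarrow> (\<forall>s\<in>atoms (Game L R). l \<le> s)) \<and>
     (\<forall>r. R = Atom r \<longrightarrow> (\<forall>s\<in>atoms (Game L R). s \<le> r))"
proof -
  have "guaranteed (Game L R) \<longleftrightarrow>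
     (\<forall>H. H |\<in>| side_opts L \<longrightarrow> guaranteed H) \<and> (\<forall>H. H |\<in>| side_opts R \<longrightarrow> guaranteed H) \<and>
     (\<forall>l. L = Atom l \<longrightarrow> (\<forall>s\<in>atoms (Game L R). l \<le> s)) \<and>
     (\<forall>r. R = Atom r \<longrightarrow> (\<forall>s\<in>atoms (Game L R). s \<le> r))"
    unfolding guaranteed_def
    by (subst follower.simps) (auto simp: left_opts_def right_opts_def)
  then show ?thesis by (auto simp: GS_def scoring_game_Game)
qed

lemma GS_scoring_game: "G \<in> GS \<Longrightarrow> scoring_game G"
  by (simp add: GS_def)

lemma GS_sides: "G \<in> GS \<Longrightarrow> left G \<noteq> Opts {||} \<and> right G \<noteq> Opts {||}"
  by (simp add: GS_scoring_game scoring_game_sides)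

lemma GS_left_opt: "G \<in> GS \<Longrightarrow> G' |\<in>| left_opts G \<Longrightarrow> G' \<in> GS"
  by (cases G) (simp add: GS_Game left_opts_def)

lemma GS_right_opt: "G \<in> GS \<Longrightarrow> G' |\<in>| right_opts G \<Longrightarrow> G' \<in> GS"
  by (cases G) (simp add: GS_Game right_opts_def)

lemma GS_left_atom_le: "G \<in> GS \<Longrightarrow> left G = Atom l \<Longrightarrow> \<forall>s\<in>atoms G. l \<le> s"
  by (cases G) (simp add: GS_Game)

lemma GS_le_right_atom: "G \<in> GS \<Longrightarrow> right G = Atom r \<Longrightarrow> \<forall>s\<in>atoms G. s \<le> r"
  by (cases G) (simp add: GS_Game)

lemma GS_Game_left_atom:
  assumes "B \<in> GS" "\<forall>s\<in>atoms B. l \<le> s"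
  shows "Game (Atom l) (Opts {|B|}) \<in> GS"
  using assms by (auto simp: GS_Game atoms_Game)

subsection \<open>Right-pass-allowed stops\<close>

abbreviation neg_waiting :: "nat \<Rightarrow> game" where
  "neg_waiting k \<equiv> conjugate (waiting k)"

lemma left_neg_waiting: "left (neg_waiting k) = Atom 0"
  by (cases k) auto

lemma neg_waiting_right_opt: "neg_waiting k |\<in>| right_opts (neg_waiting (Suc k))"
  by (simp add: right_opts_def)

lemma GS_neg_waiting: "neg_waiting k \<in> GS"
proof (induction k)
  case (Suc k)
  then show ?case using conjugate_waiting[of "Suc k"] by (simp add: GS_Game)
qed (simp add: GS_Game atoms_Game)

lemma stops_gplus_neg_waiting_in_atoms:
  assumes "scoring_game G"
  shows "Ls (G \<oplus> neg_waiting k) \<in> atoms G \<and> Rs (G \<oplus> neg_waiting k) \<in> atoms G"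
proof -
  have "scoring_game (G \<oplus> neg_waiting k)"
    using assms conjugate_waiting by (simp add: scoring_game_gplus)
  then show ?thesis
    by (auto dest!: stops_in_atoms atoms_gplus simp: conjugate_waiting)
qed

lemma le_Ls_right_pass_iff:
  "scoring_game G \<Longrightarrow> c \<le> Ls_right_pass G \<longleftrightarrow> (\<forall>k. c \<le> Ls (G \<oplus> neg_waiting k))"
  unfolding Ls_right_pass_def by (subst Min_ge_iff) (auto intro: finite_Ls_right_pass)

lemma le_Rs_right_pass_iff:
  "scoring_game G \<Longrightarrow> c \<le> Rs_right_pass G \<longleftrightarrow> (\<forall>k. c \<le> Rs (G \<oplus> neg_waiting k))"
  unfolding Rs_right_pass_def by (subst Min_ge_iff) (auto intro: finite_Rs_right_pass)

lemma Ls_right_pass_mono: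
  assumes "scoring_game G" "scoring_game H" "G \<preceq> H"
  shows "Ls_right_pass G \<le> Ls_right_pass H"
  using assms le_Ls_right_pass_iff[of G "Ls_right_pass G"] le_Ls_right_pass_iff[of H]
    GS_neg_waiting unfolding game_ge_def by (meson order.refl order.trans)

lemma Ls_right_pass_left_atom:
  assumes "left G = Atom l"
  shows "Ls_right_pass G = l"
proof -
  have "Ls (G \<oplus> neg_waiting k) = l" for k
    by (rule Ls_left_atom) (simp add: left_gplus assms left_neg_waiting)
  then show ?thesis by (simp add: Ls_right_pass_def)
qed

lemma atoms_ge_imp_le_Rs_right_pass:
  "scoring_game G \<Longrightarrow> \<forall>s\<in>atoms G. c \<le> s \<Longrightarrow> c \<le> Rs_right_pass G"
  by (simp add: le_Rs_right_pass_iff stops_gplus_neg_waiting_in_atoms)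

lemma Ls_gplus_ge_neg_waiting_step:
  assumes Y: "Y \<in> GS" and X: "scoring_game X" "\<forall>s\<in>atoms X. x \<le> s"
    and opts: "\<And>Y'. Y' |\<in>| left_opts Y \<Longrightarrow> Rs (Y' \<oplus> neg_waiting k) + x \<le> Rs (Y' \<oplus> X)"
  shows "Ls (Y \<oplus> neg_waiting k) + x \<le> Ls (Y \<oplus> X)"
proof -
  have "left Y \<noteq> Opts {||}" "left (neg_waiting k) \<noteq> Opts {||}"
    using GS_sides[OF Y] by (simp_all add: left_neg_waiting)
  then show ?thesis
  proof (cases rule: Ls_gplus_cases)
    case (atoms s t)
    then have "Ls (Y \<oplus> neg_waiting k) = s" by (simp add: left_neg_waiting)
    moreover have "Ls (Y \<oplus> X) \<in> atoms (Y \<oplus> X)"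
      using stops_in_atoms scoring_game_gplus[OF GS_scoring_game[OF Y] X(1)] by blast
    ultimately show ?thesis
      using atoms_gplus_ge[OF GS_left_atom_le[OF Y atoms(1)] X(2)] by simp
  next
    case (fst Y')
    then show ?thesis
      using opts[OF fst(1)] Rs_left_opt_gplus_le_Ls[OF fst(1), of X] by simp
  qed (simp add: left_neg_waiting left_opts_def)
qed

lemma Rs_gplus_ge_neg_waiting_step:
  assumes Y: "Y \<in> GS" and X: "scoring_game X" "\<forall>s\<in>atoms X. x \<le> s"
    and opts: "\<And>Y'. Y' |\<in>| right_opts Y \<Longrightarrow> Ls (Y' \<oplus> neg_waiting k) + x \<le> Ls (Y' \<oplus> X)"
      "\<And>X'. X' |\<in>| right_opts X \<Longrightarrow>
         \<exists>j. k = Suc j \<and> Ls (Y \<oplus> neg_waiting j) + x \<le> Ls (Y \<oplus> X')"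
  shows "Rs (Y \<oplus> neg_waiting k) + x \<le> Rs (Y \<oplus> X)"
proof -
  have "right Y \<noteq> Opts {||}" "right X \<noteq> Opts {||}"
    using GS_sides[OF Y] scoring_game_sides[OF X(1)] by simp_all
  then show ?thesis
  proof (cases rule: Rs_gplus_cases)
    case (atoms s t)
    have "Rs (Y \<oplus> neg_waiting k) \<le> s"
      using stops_gplus_neg_waiting_in_atoms[OF GS_scoring_game[OF Y]]
        GS_le_right_atom[OF Y atoms(1)] by blast
    moreover have "x \<le> t" using X(2) right_atom_in_atoms[OF atoms(2)] by blast
    ultimately show ?thesis using atoms(3) by simp
  next
    case (fst Y')
    then show ?thesis
      using opts(1)[OF fst(1)] Rs_le_Ls_right_opt_gplus[OF fst(1), of "neg_waiting k"] by simp
  next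
    case (snd X')
    then obtain j where j: "k = Suc j" "Ls (Y \<oplus> neg_waiting j) + x \<le> Ls (Y \<oplus> X')"
      using opts(2) by blast
    have "Rs (Y \<oplus> neg_waiting k) \<le> Ls (Y \<oplus> neg_waiting j)"
      unfolding j(1) by (intro Rs_le_Ls_gplus_right_opt neg_waiting_right_opt)
    then show ?thesis using j(2) snd(2) by simp
  qed
qed

lemma stops_gplus_ge_neg_waiting:
  assumes "Y \<in> GS" "scoring_game X" "\<forall>s\<in>atoms X. x \<le> s" "size X \<le> k"
  shows "Ls (Y \<oplus> neg_waiting k) + x \<le> Ls (Y \<oplus> X) \<and>
         Rs (Y \<oplus> neg_waiting k) + x \<le> Rs (Y \<oplus> X)"
  using assms
proof (induction "size Y + size X" arbitrary: Y X k rule: less_induct)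
  case less
  note Y = less.prems(1) and X = less.prems(2-4)
  have "Rs (Y' \<oplus> neg_waiting k) + x \<le> Rs (Y' \<oplus> X)" if "Y' |\<in>| left_opts Y" for Y'
    using less.hyps[of Y' X k] GS_left_opt[OF Y that] X size_left_opt[OF that] by simp
  moreover have "Ls (Y' \<oplus> neg_waiting k) + x \<le> Ls (Y' \<oplus> X)" if "Y' |\<in>| right_opts Y" for Y'
    using less.hyps[of Y' X k] GS_right_opt[OF Y that] X size_right_opt[OF that] by simp
  moreover have "\<exists>j. k = Suc j \<and> Ls (Y \<oplus> neg_waiting j) + x \<le> Ls (Y \<oplus> X')"
    if X': "X' |\<in>| right_opts X" for X'
  proof -
    have size: "size X' < size X" using X' by (rule size_right_opt)
    then obtain j where j: "k = Suc j" "size X' \<le> j" using X(3) by (cases k) auto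
    have "Ls (Y \<oplus> neg_waiting j) + x \<le> Ls (Y \<oplus> X')"
      using less.hyps[of Y X' j] size j(2) Y scoring_game_right_opt[OF X(1) X'] X(2)
        atoms_right_opt[OF X'] by auto
    then show ?thesis using j(1) by blast
  qed
  ultimately show ?case
    by (intro conjI Ls_gplus_ge_neg_waiting_step[OF Y X(1,2)]
        Rs_gplus_ge_neg_waiting_step[OF Y X(1,2)])
qed

lemma Rs_gplus_ge_Rs_right_pass:
  assumes "Y \<in> GS" "X \<in> GS" "left X = Atom x"
  shows "Rs_right_pass Y + x \<le> Rs (Y \<oplus> X)"
proof -
  have "Rs_right_pass Y \<le> Rs (Y \<oplus> neg_waiting (size X))"
    using le_Rs_right_pass_iff[OF GS_scoring_game[OF assms(1)]] by blast
  moreover have "Rs (Y \<oplus> neg_waiting (size X)) + x \<le> Rs (Y \<oplus> X)"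
    using stops_gplus_ge_neg_waiting[OF assms(1) GS_scoring_game[OF assms(2)]
        GS_left_atom_le[OF assms(2,3)] order.refl] by blast
  ultimately show ?thesis by simp
qed

subsection \<open>Games with the same right side\<close>

text \<open>
  The second disjunct lets Left answer in \<open>X\<close>; it is phrased with \<open>Q\<close> rather than \<open>P\<close> because
  the induction on \<open>X\<close> that proves \<open>P \<succeq> Q\<close> can replace one by the other.
\<close>

definition covers :: "game \<Rightarrow> game \<Rightarrow> game \<Rightarrow> bool" where
  "covers P Q Q' \<longleftrightarrow> (\<forall>X\<in>GS. Rs (Q' \<oplus> X) \<le> Ls (P \<oplus> X) \<or>
     (\<exists>X'. X' |\<in>| left_opts X \<and> Rs (Q' \<oplus> X) \<le> Rs (Q \<oplus> X')))"

lemma covers_left_opt: "Q' |\<in>| left_opts P \<Longrightarrow> covers P Q Q'"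
  unfolding covers_def by (blast intro: Rs_left_opt_gplus_le_Ls)

lemma covers_reversible:
  assumes "B |\<in>| right_opts Q'" "B \<preceq> P"
  shows "covers P Q Q'"
  using assms Rs_le_Ls_right_opt_gplus[OF assms(1)] unfolding covers_def game_ge_def
  by (blast intro: order.trans)

lemma covers_atomic_reversible:
  assumes B: "B |\<in>| right_opts A" "left B = Atom l" "B \<preceq> Q"
    and atom: "\<And>X x. X \<in> GS \<Longrightarrow> left X = Atom x \<Longrightarrow> l + x \<le> Ls (P \<oplus> X)"
  shows "covers P Q A"
  unfolding covers_def
proof
  fix X assume X: "X \<in> GS"
  have A_le_B: "Rs (A \<oplus> X) \<le> Ls (B \<oplus> X)" using B(1) by (rule Rs_le_Ls_right_opt_gplus)
  have "left B \<noteq> Opts {||}" "left X \<noteq> Opts {||}" using B(2) GS_sides[OF X] by simp_all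
  then show "Rs (A \<oplus> X) \<le> Ls (P \<oplus> X) \<or>
    (\<exists>X'. X' |\<in>| left_opts X \<and> Rs (A \<oplus> X) \<le> Rs (Q \<oplus> X'))"
  proof (cases rule: Ls_gplus_cases)
    case (atoms s t)
    then show ?thesis using A_le_B B(2) atom[OF X] by fastforce
  next
    case (fst B')
    then show ?thesis using B(2) by (simp add: left_opts_def)
  next
    case (snd X')
    then have "Rs (B \<oplus> X') \<le> Rs (Q \<oplus> X')"
      using B(3) GS_left_opt[OF X] by (simp add: game_ge_def)
    then show ?thesis using A_le_B snd by force
  qed
qed

lemma game_ge_same_right:
  assumes Q: "left_opts Q \<noteq> {||}" and right: "right P = right Q" "right P \<noteq> Opts {||}"
    and covers: "\<And>Q'. Q' |\<in>| left_opts Q \<Longrightarrow> covers P Q Q'"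
  shows "P \<succeq> Q"
proof -
  have "Ls (Q \<oplus> X) \<le> Ls (P \<oplus> X) \<and> Rs (Q \<oplus> X) \<le> Rs (P \<oplus> X)" if "X \<in> GS" for X
    using that
  proof (induction "size X" arbitrary: X rule: less_induct)
    case less
    note X = less.prems
    have move_in_X: "Rs (Q \<oplus> X') \<le> Ls (P \<oplus> X)" if "X' |\<in>| left_opts X" for X'
      using less.hyps[OF size_left_opt[OF that] GS_left_opt[OF X that]]
        Rs_gplus_left_opt_le_Ls[OF that, of P] by simp
    have "left Q \<noteq> Opts {||}" "left X \<noteq> Opts {||}"
      using Q GS_sides[OF X] by (auto simp: left_opts_def)
    then have "Ls (Q \<oplus> X) \<le> Ls (P \<oplus> X)"
    proof (cases rule: Ls_gplus_cases)
      case (fst Q')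
      then show ?thesis
        using covers X move_in_X unfolding covers_def by (metis order.trans)
    qed (use Q move_in_X in \<open>auto simp: left_opts_def\<close>)
    moreover have "right P \<noteq> Opts {||}" "right X \<noteq> Opts {||}"
      using right(2) GS_sides[OF X] by simp_all
    then have "Rs (Q \<oplus> X) \<le> Rs (P \<oplus> X)"
    proof (cases rule: Rs_gplus_cases)
      case (atoms s t)
      then show ?thesis using right(1) by (simp add: right_gplus Rs_right_atom)
    next
      case (fst P')
      then show ?thesis using right(1) by (simp add: right_opts_def Rs_le_Ls_right_opt_gplus)
    next
      case (snd X')
      then show ?thesis
        using less.hyps[OF size_right_opt[OF snd(1)] GS_right_opt[OF X snd(1)]]
          Rs_le_Ls_gplus_right_opt[OF snd(1), of Q] by simp
    qed
    ultimately show ?case by blast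
  qed
  then show ?thesis by (simp add: game_ge_def)
qed

subsection \<open>Atomic reversibility\<close>

lemma game_equiv_replace_atomic_reversible:
  assumes G: "G \<in> GS" "A |\<in>| left_opts G"
    and B: "B |\<in>| right_opts A" "left B = Atom l" "B \<preceq> G"
    and S: "left_opts G |-| {|A|} |\<subseteq>| S"
      "\<And>D. D |\<in>| S \<Longrightarrow> D |\<notin>| left_opts G \<Longrightarrow> \<exists>D'. D' |\<in>| right_opts D \<and> D' \<preceq> G"
    and C: "C |\<in>| S" "C \<in> GS" "l \<le> Rs_right_pass C"
  shows "G \<sim> Game (Opts S) (right G)" (is "G \<sim> ?H")
proof -
  have H: "left_opts ?H = S" by (simp add: left_opts_def)
  have "G \<succeq> ?H"
  proof (rule game_ge_same_right)
    show "covers G ?H D" if "D |\<in>| left_opts ?H" for D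
      using that S(2) covers_left_opt covers_reversible unfolding H by blast
  qed (use C(1) H GS_sides[OF G(1)] in auto)
  moreover have "?H \<succeq> G"
  proof (rule game_ge_same_right)
    have "l + x \<le> Ls (?H \<oplus> X)" if "X \<in> GS" "left X = Atom x" for X x
    proof -
      have "l + x \<le> Rs_right_pass C + x" using C(3) by simp
      also have "\<dots> \<le> Rs (C \<oplus> X)" using C(2) that by (rule Rs_gplus_ge_Rs_right_pass)
      also have "\<dots> \<le> Ls (?H \<oplus> X)" using C(1) H by (intro Rs_left_opt_gplus_le_Ls) simp
      finally show ?thesis .
    qed
    with B have "covers ?H G A" by (rule covers_atomic_reversible)
    then show "covers ?H G G'" if "G' |\<in>| left_opts G" for G'
      using that S(1) H by (cases "G' = A") (auto intro: covers_left_opt)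
  qed (use G(2) GS_sides[OF G(1)] in auto)
  ultimately show ?thesis by (simp add: game_equiv_def)
qed

theorem theorem32:
  fixes G A B :: game and l :: real
  assumes "G \<in> GS"
    and "A |\<in>| left_opts G"
    and "B |\<in>| right_opts A" and "left B = Atom l" and "B \<preceq> G"
  shows "((\<exists>GL. GL |\<in>| left_opts G |-| {|A|} \<and> Ls_right_pass G = Rs_right_pass GL) \<longrightarrow>
            G \<sim> Game (Opts (left_opts G |-| {|A|})) (right G))
       \<and> ((Ls_right_pass G = Rs_right_pass A \<and>
            (\<forall>GL. GL |\<in>| left_opts G |-| {|A|} \<longrightarrow> Rs_right_pass A > Rs_right_pass GL)) \<longrightarrow>
            G \<sim> Game (Opts (finsert (Game (Atom l) (Opts {|B|})) (left_opts G |-| {|A|}))) (right G))"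
proof (intro conjI impI)
  have B: "B \<in> GS" using assms(1-3) by (blast intro: GS_left_opt GS_right_opt)
  show "G \<sim> Game (Opts (left_opts G |-| {|A|})) (right G)"
    if dominating: "\<exists>GL. GL |\<in>| left_opts G |-| {|A|} \<and> Ls_right_pass G = Rs_right_pass GL"
  proof -
    obtain GL where GL: "GL |\<in>| left_opts G |-| {|A|}" "Ls_right_pass G = Rs_right_pass GL"
      using dominating by blast
    have "l \<le> Rs_right_pass GL"
      using Ls_right_pass_mono[OF B[THEN GS_scoring_game] assms(1)[THEN GS_scoring_game] assms(5)]
      by (simp add: Ls_right_pass_left_atom[OF assms(4)] GL(2))
    then show ?thesis
      using GL(1) GS_left_opt[OF assms(1)]
      by (intro game_equiv_replace_atomic_reversible[OF assms, of _ GL]) auto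
  qed
  let ?C = "Game (Atom l) (Opts {|B|})"
  have C: "?C \<in> GS" using B GS_left_atom_le[OF B assms(4)] by (rule GS_Game_left_atom)
  then have "l \<le> Rs_right_pass ?C"
    using GS_left_atom_le[OF C] by (simp add: atoms_ge_imp_le_Rs_right_pass GS_scoring_game)
  then show "G \<sim> Game (Opts (finsert ?C (left_opts G |-| {|A|}))) (right G)"
    using C assms(5)
    by (intro game_equiv_replace_atomic_reversible[OF assms, of _ ?C]) (auto simp: right_opts_def)
qed

end
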